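(* For every integer $n \ge 3$, the reverse permutation $R_n = (n, n-1, \ldots, 2, 1)$ can be transformed into the identity permutation $I_n = (1,2,\ldots,n)$ by a sequence of $J'(n)$ LRE moves, where $J'(3)=2$, $J'(4)=4$, $J'(5)=8$, $J'(6)=13$, $J'(7)=20$, and for $n \ge 8$, $J'(n) = \frac{3n^2-20n+72}{4}$ if $n$ is even and $J'(n) = \frac{3n^2-20n+73}{4}$ if $n$ is odd. In particular, at most $\frac{3}{4}n^2$ LRE moves suffice to sort $R_n$.
   Context: Permutations of $\{1,\ldots,n\}$ are written as sequences $(a_1,\ldots,a_n)$. The LRE moves are: $L$ (left rotate), $(a_1,\ldots,a_n)\mapsto(a_2,\ldots,a_n,a_1)$; $R$ (right rotate), $(a_1,\ldots,a_n)\mapsto(a_n,a_1,\ldots,a_{n-1})$; $E$ (exchange), $(a_1,a_2,a_3,\ldots,a_n)\mapsto(a_2,a_1,a_3,\ldots,a_n)$. Moves are applied one after another. *)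

theory Defs
  imports Complex_Main
begin

datatype lre_move = MoveL | MoveR | MoveE

text \<open>A permutation \<open>(a\<^sub>1, \<dots>, a\<^sub>n)\<close> is the list of its entries. The values of
  the moves on lists with fewer than three entries are irrelevant.\<close>

fun exchange :: "'a list \<Rightarrow> 'a list" where
  "exchange (x # y # zs) = y # x # zs"
| "exchange xs = xs"

fun apply_move :: "lre_move \<Rightarrow> 'a list \<Rightarrow> 'a list" where
  "apply_move MoveL xs = rotate1 xs"
| "apply_move MoveR xs = last xs # butlast xs"
| "apply_move MoveE xs = exchange xs"

text \<open>The head of the list of moves is applied first.\<close>

definition apply_moves :: "lre_move list \<Rightarrow> 'a list \<Rightarrow> 'a list" where
  "apply_moves ms xs = fold apply_move ms xs"

definition identity_perm :: "nat \<Rightarrow> nat list" where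
  "identity_perm n = [1..<Suc n]"

definition reverse_perm :: "nat \<Rightarrow> nat list" where
  "reverse_perm n = rev [1..<Suc n]"

text \<open>Real-valued, so that neither subtraction nor division truncates. The values for
  \<open>n < 3\<close> are irrelevant.\<close>

definition J' :: "nat \<Rightarrow> real" where
  "J' n =
    (if n = 3 then 2
     else if n = 4 then 4
     else if n = 5 then 8
     else if n = 6 then 13
     else if n = 7 then 20
     else if even n then (3 * real n ^ 2 - 20 * real n + 72) / 4
     else (3 * real n ^ 2 - 20 * real n + 73) / 4)"

end

theory Submission
  imports Defs
begin

text \<open>Place the entries on a circle, so that \<open>L\<close> and \<open>R\<close> move a pointer and \<open>E\<close> swaps the two
  entries at the pointer. Reversing two complementary arcs separately reverses the whole circle,
  because \<open>rev (A @ B) = rev B @ rev A\<close> is a rotation of \<open>rev A @ rev B\<close>. A cocktail-shaker pass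
  carries the first entry of an arc to its end and then the last entry to its front, with one
  pointer move between consecutive swaps; so an arc of length \<open>m\<close> is reversed by
  \<open>m (m - 1) - 1\<close> moves, ending near its middle. Taking arcs of lengths \<open>n div 2\<close> and
  \<open>n - n div 2\<close> and adding the pointer moves between the arcs gives a sequence that is no longer
  than \<open>J' n\<close> and has the same parity, and it is padded with pairs \<open>L R\<close>.\<close>

lemma apply_moves_simps [simp]:
  "apply_moves [] xs = xs"
  "apply_moves (m # ms) xs = apply_moves ms (apply_move m xs)"
  "apply_moves (ms @ ms') xs = apply_moves ms' (apply_moves ms xs)"
  by (simp_all add: apply_moves_def)

lemma apply_moves_replicate_L: "apply_moves (replicate k MoveL) xs = rotate k xs"
  by (induction k arbitrary: xs) (simp_all add: rotate1_rotate_swap)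

lemma moveR_rotate1: "xs \<noteq> [] \<Longrightarrow> apply_move MoveR (rotate1 xs) = xs"
  by (cases xs) auto

lemma apply_moves_replicate_R_rotate:
  "xs \<noteq> [] \<Longrightarrow> apply_moves (replicate k MoveR) (rotate k xs) = xs"
  by (induction k) (simp_all add: moveR_rotate1 del: apply_move.simps)

lemma apply_moves_pad:
  assumes "xs \<noteq> []"
  shows "apply_moves (concat (replicate k [MoveL, MoveR])) xs = xs"
  using assms by (induction k) (simp_all add: moveR_rotate1 del: apply_move.simps(2))

text \<open>Each \<open>E L\<close> swaps \<open>a\<close> with the entry after it and moves the
  pointer back onto \<open>a\<close>; the passed entry, now behind the pointer, sits at the end of
  the list.\<close>

lemma apply_moves_carry_right:
  "apply_moves (concat (replicate (length zs) [MoveE, MoveL])) (a # zs @ ys) = a # ys @ zs"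
proof (induction zs arbitrary: ys)
  case (Cons z zs)
  show ?case using Cons.IH[of "ys @ [z]"] by simp
qed simp

lemma apply_moves_carry_left:
  "apply_moves (concat (replicate (length zs) [MoveR, MoveE])) (b # ys @ zs) = b # zs @ ys"
proof (induction zs arbitrary: ys rule: rev_induct)
  case (snoc z zs)
  have "apply_move MoveR (b # ys @ zs @ [z]) = z # b # ys @ zs"
    by (simp add: butlast_append)
  then show ?case using snoc.IH[of "z # ys"] by (simp del: apply_move.simps(2))
qed simp

definition shaker_pass :: "nat \<Rightarrow> lre_move list" where
  "shaker_pass k = concat (replicate k [MoveE, MoveL]) @ MoveE #
     concat (replicate k [MoveR, MoveE])"

lemma length_shaker_pass: "length (shaker_pass k) = 4 * k + 1"
  by (simp add: shaker_pass_def length_concat sum_list_replicate)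

text \<open>Carrying \<open>a\<close> right sends \<open>xs\<close> behind the pointer and brings
  \<open>a\<close> next to \<open>b\<close>; the middle \<open>E\<close> swaps the two, and carrying
  \<open>b\<close> back retrieves \<open>xs\<close> in its original order.\<close>

lemma apply_moves_shaker_pass:
  "apply_moves (shaker_pass (length xs)) (a # xs @ b # ys) = b # xs @ a # ys"
  using apply_moves_carry_right[of xs a "b # ys"] apply_moves_carry_left[of xs b "a # ys"]
  by (simp add: shaker_pass_def)

text \<open>Each level swaps the two ends of the arc and steps one place inward, so the rotation
  counts the steps made before the innermost pass, on two or three entries.\<close>

lemma reverse_arc:
  assumes "length xs \<ge> 2"
  shows "\<exists>ms. length ms + 1 = length xs * (length xs - 1) \<and>
    apply_moves ms (xs @ ys) = rotate (length xs div 2 - 1) (rev xs @ ys)"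
  using assms
proof (induction "length xs" arbitrary: xs ys rule: less_induct)
  case less
  obtain a zs b where xs: "xs = a # zs @ [b]"
    using less.prems
    by (metis Suc_le_length_iff append_butlast_last_id list.size(3) not_less_eq_eq
        numeral_2_eq_2 zero_le)
  let ?k = "length zs"
  show ?case
  proof (cases "?k \<ge> 2")
    case True
    \<comment> \<open>After the pass and one \<open>L\<close> the list is
      \<open>zs @ a # ys @ [b]\<close>: the swapped ends now belong to the rest of the
      circle.\<close>
    obtain ms where ms: "length ms + 1 = ?k * (?k - 1)"
      "apply_moves ms (zs @ a # ys @ [b]) = rotate (?k div 2 - 1) (rev zs @ a # ys @ [b])"
      using less.hyps[of zs "a # ys @ [b]"] True xs by auto
    let ?ms = "shaker_pass ?k @ MoveL # ms"
    have "apply_moves ?ms (xs @ ys) = rotate (?k div 2 - 1) (rotate1 (b # rev zs @ a # ys))"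
      using ms(2) by (simp add: xs apply_moves_shaker_pass)
    also have "\<dots> = rotate (Suc (?k div 2 - 1)) (b # rev zs @ a # ys)"
      by (simp only: rotate_Suc rotate1_rotate_swap)
    also have "\<dots> = rotate (length xs div 2 - 1) (rev xs @ ys)"
      using True by (simp add: xs)
    finally have "apply_moves ?ms (xs @ ys) = rotate (length xs div 2 - 1) (rev xs @ ys)" .
    moreover have "length ?ms + 1 = length xs * (length xs - 1)"
    proof -
      obtain j where "?k = Suc j" using True by (cases ?k) auto
      then show ?thesis using ms(1) by (simp add: xs length_shaker_pass algebra_simps)
    qed
    ultimately show ?thesis by blast
  next
    case False
    \<comment> \<open>Here \<open>zs\<close> is its own reverse, so the pass alone finishes, with no
      \<open>L\<close> after it.\<close>
    then have "zs = [] \<or> (\<exists>z. zs = [z])"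
      by (cases zs) (auto simp: not_le less_Suc_eq_le numeral_2_eq_2)
    then have "length (shaker_pass ?k) + 1 = length xs * (length xs - 1)"
      "apply_moves (shaker_pass ?k) (xs @ ys) = rotate (length xs div 2 - 1) (rev xs @ ys)"
      using apply_moves_shaker_pass[of zs a b ys] by (auto simp: xs length_shaker_pass)
    then show ?thesis by blast
  qed
qed

text \<open>From the middle of the arc the pointer goes on with \<open>L\<close> until it stands at
  the start of the other arc. Arcs of length 0 and 1 are covered as well.\<close>

lemma reverse_arc_to_end:
  "\<exists>ms. length ms = length xs * (length xs - 1) + (length xs + 1) div 2 \<and>
    apply_moves ms (xs @ ys) = ys @ rev xs"
proof (cases "length xs \<ge> 2")
  case True
  let ?m = "length xs"
  obtain ms where ms: "length ms + 1 = ?m * (?m - 1)"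
    "apply_moves ms (xs @ ys) = rotate (?m div 2 - 1) (rev xs @ ys)"
    using reverse_arc[OF True] by blast
  let ?ms = "ms @ replicate ((?m + 1) div 2 + 1) MoveL"
  have "(?m + 1) div 2 + 1 + (?m div 2 - 1) = ?m" using True by linarith
  then have "apply_moves ?ms (xs @ ys) = rotate (length (rev xs)) (rev xs @ ys)"
    by (simp only: apply_moves_simps ms(2) apply_moves_replicate_L rotate_rotate length_rev)
  then have "apply_moves ?ms (xs @ ys) = ys @ rev xs"
    by (simp only: rotate_append)
  moreover have "length ?ms = ?m * (?m - 1) + (?m + 1) div 2" using ms(1) by simp
  ultimately show ?thesis by blast
next
  case False
  then consider "xs = []" | x where "xs = [x]"
    by (cases xs) (auto simp: not_le less_Suc_eq_le numeral_2_eq_2)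
  then show ?thesis
  proof cases
    case 1
    then show ?thesis by simp
  next
    case 2
    then show ?thesis by (intro exI[of _ "[MoveL]"]) simp
  qed
qed

lemma reverse_arc_to_front:
  assumes "length xs \<ge> 2"
  shows "\<exists>ms. length ms + 2 = length xs * (length xs - 1) + length xs div 2 \<and>
    apply_moves ms (xs @ ys) = rev xs @ ys"
proof -
  let ?m = "length xs"
  obtain ms where ms: "length ms + 1 = ?m * (?m - 1)"
    "apply_moves ms (xs @ ys) = rotate (?m div 2 - 1) (rev xs @ ys)"
    using reverse_arc[OF assms] by blast
  let ?ms = "ms @ replicate (?m div 2 - 1) MoveR"
  have ne: "rev xs @ ys \<noteq> []" using assms by auto
  have "apply_moves ?ms (xs @ ys) = rev xs @ ys"
    by (simp only: apply_moves_simps ms(2) apply_moves_replicate_R_rotate[OF ne])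
  moreover have "length ?ms + 2 = ?m * (?m - 1) + ?m div 2"
    using ms(1) assms by simp
  ultimately show ?thesis by blast
qed

lemma reverse_by_arcs:
  assumes "length ys \<ge> 2"
  shows "\<exists>ms. length ms + 2 = length xs * (length xs - 1) + (length xs + 1) div 2
      + length ys * (length ys - 1) + length ys div 2 \<and>
    apply_moves ms (xs @ ys) = rev (xs @ ys)"
proof -
  obtain ms where ms: "length ms = length xs * (length xs - 1) + (length xs + 1) div 2"
    "apply_moves ms (xs @ ys) = ys @ rev xs"
    using reverse_arc_to_end by blast
  obtain ms' where ms': "length ms' + 2 = length ys * (length ys - 1) + length ys div 2"
    "apply_moves ms' (ys @ rev xs) = rev ys @ rev xs"
    using reverse_arc_to_front[OF assms] by blast
  show ?thesis using ms ms' by (intro exI[of _ "ms @ ms'"]) simp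
qed

text \<open>The polynomial is the move count for two arcs of length \<open>m\<close>. For
  \<open>m \<ge> 4\<close>, \<open>J'\<close> exceeds it by \<open>(m - 4) * (m - 5)\<close>, a
  product of consecutive integers and hence even; for \<open>m = 2\<close> and \<open>m = 3\<close>
  the two agree.\<close>

lemma J'_even:
  assumes "m \<ge> 2"
  shows "\<exists>j. J' (2 * m) = 2 * real m ^ 2 - real m - 2 + 2 * real j"
proof (cases "m \<ge> 4")
  case True
  obtain i where i: "m = i + 4" using True le_Suc_ex by (metis add.commute)
  have "even (i * (i - 1))" by (cases i) auto
  then obtain j where "i * (i - 1) = 2 * j" by blast
  then have "real (i * (i - 1)) = 2 * real j" by simp
  then have "real i * (real i - 1) = 2 * real j" by (cases i) (simp_all add: algebra_simps)
  moreover have "J' (2 * m) = 2 * real m ^ 2 - real m - 2 + real i * (real i - 1)"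
    by (simp add: J'_def i power2_eq_square field_simps)
  ultimately show ?thesis by auto
next
  case False
  then have "m = 2 \<or> m = 3" using assms by auto
  then show ?thesis by (auto simp: J'_def)
qed

text \<open>The expression is the move count for arcs of lengths \<open>k\<close> and
  \<open>k + 1\<close>. For \<open>k \<ge> 4\<close>, \<open>J'\<close> exceeds it by
  \<open>(k - 4)^2\<close> if \<open>k\<close> is even and by \<open>(k - 3) * (k - 5)\<close> if
  \<open>k\<close> is odd; for smaller \<open>k\<close> the two agree.\<close>

lemma J'_odd:
  assumes "k \<ge> 1"
  shows "\<exists>j. J' (2 * k + 1) = 2 * real k ^ 2 + 2 * real ((k + 1) div 2) - 2 + 2 * real j"
proof (cases "k \<ge> 4")
  case True
  show ?thesis
  proof (cases "even k")
    case True
    then obtain i where "k = 2 * i" by blast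
    moreover define h where "h = i - 2"
    ultimately have k: "k = 2 * h + 4" using \<open>k \<ge> 4\<close> by simp
    show ?thesis
      by (rule exI[of _ "2 * h ^ 2"]) (simp add: J'_def k power2_eq_square field_simps)
  next
    case False
    then obtain i where "k = 2 * i + 1" by (blast elim: oddE)
    moreover define h where "h = i - 2"
    ultimately have k: "k = 2 * h + 5" using \<open>k \<ge> 4\<close> by simp
    show ?thesis
      by (rule exI[of _ "2 * h * (h + 1)"]) (simp add: J'_def k power2_eq_square field_simps)
  qed
next
  case False
  then have "k = 1 \<or> k = 2 \<or> k = 3" using assms by auto
  then show ?thesis by (auto simp: J'_def)
qed

lemma J'_le:
  assumes "n \<ge> 3"
  shows "J' n \<le> 3 / 4 * real n ^ 2"
proof -
  \<comment> \<open>From 4 on, \<open>20 * n\<close> exceeds both constants 72 and 73.\<close>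
  have "n = 3 \<or> real n \<ge> 4" using assms by auto
  then show ?thesis by (auto simp: J'_def field_simps)
qed

theorem theorem2:
  fixes n :: nat
  assumes "n \<ge> 3"
  shows "(\<exists>ms. real (length ms) = J' n \<and>
            apply_moves ms (reverse_perm n) = identity_perm n) \<and>
         (\<exists>ms. real (length ms) \<le> 3 / 4 * real n ^ 2 \<and>
            apply_moves ms (reverse_perm n) = identity_perm n)"
proof -
  \<comment> \<open>The shorter half comes first: for \<open>n = 3\<close> it is a single entry,
    while the second arc must have at least two.\<close>
  define xs where "xs = take (n div 2) (reverse_perm n)"
  define ys where "ys = drop (n div 2) (reverse_perm n)"
  have len: "length xs = n div 2" "length ys = n - n div 2"
    by (simp_all add: xs_def ys_def reverse_perm_def)
  have app: "xs @ ys = reverse_perm n" by (simp add: xs_def ys_def)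
  have "length ys \<ge> 2" using assms len by linarith
  then obtain ms where ms: "length ms + 2 = length xs * (length xs - 1) + (length xs + 1) div 2
      + length ys * (length ys - 1) + length ys div 2"
    "apply_moves ms (xs @ ys) = rev (xs @ ys)"
    using reverse_by_arcs by blast
  have "\<exists>j. J' n = real (length ms) + 2 * real j"
  proof (cases "even n")
    case True
    then obtain m where n: "n = 2 * m" by blast
    then obtain p where p: "m = Suc p" using assms by (cases m) auto
    have "length ms + 2 = 2 * (m * p) + m" using ms(1) by (simp add: len n p)
    then have "real (length ms) + 2 = 2 * (real m * real p) + real m"
      by (metis of_nat_add of_nat_mult of_nat_numeral)
    then have "real (length ms) = 2 * real m ^ 2 - real m - 2"
      by (simp add: p power2_eq_square algebra_simps)
    then show ?thesis using J'_even[of m] assms n by simp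
  next
    case False
    then obtain k where n: "n = 2 * k + 1" by (blast elim: oddE)
    then obtain p where p: "k = Suc p" using assms by (cases k) auto
    have "length ms + 2 = 2 * (k * k) + 2 * ((k + 1) div 2)"
      using ms(1) by (simp add: len n p algebra_simps)
    then have "real (length ms) + 2 = 2 * (real k * real k) + 2 * real ((k + 1) div 2)"
      by (metis of_nat_add of_nat_mult of_nat_numeral)
    then have "real (length ms) = 2 * real k ^ 2 + 2 * real ((k + 1) div 2) - 2"
      by (simp add: power2_eq_square)
    then show ?thesis using J'_odd[of k] assms n by simp
  qed
  then obtain j where j: "J' n = real (length ms) + 2 * real j" by blast
  let ?ms = "ms @ concat (replicate j [MoveL, MoveR])"
  have "identity_perm n \<noteq> []" using assms by (simp add: identity_perm_def)
  then have "apply_moves ?ms (reverse_perm n) = identity_perm n"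
    using ms(2) apply_moves_pad[of "identity_perm n"]
    by (simp add: app reverse_perm_def identity_perm_def)
  moreover have "real (length ?ms) = J' n"
    by (simp add: j length_concat sum_list_replicate)
  ultimately show ?thesis using J'_le[OF assms] by metis
qed

end
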